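(* Let $f=h+\overline{g}$ be a harmonic entire mapping such that $f$, $h$ and $g$ are of order $\rho$, $\rho_h$ and $\rho_g$, respectively. Then $\rho=\max\{\rho_h,\rho_g\}$. Moreover, if $0<\rho_h<\infty$ and $0<\rho_g<\infty$, and the types of $f$, $h$ and $g$ are denoted by $\tau$, $\tau_h$ and $\tau_g$, respectively, then $$\tau=\begin{cases}\tau_h & \text{if }\rho_g<\rho_h,\\ \tau_g & \text{if }\rho_g>\rho_h,\\ \max\{\tau_h,\tau_g\} & \text{if }\rho_h=\rho_g.\end{cases}$$
   Context: A harmonic entire mapping is a complex-valued harmonic function $f$ on $\mathbb{C}$; it has a canonical decomposition $f=h+\overline{g}$ with $h,g$ entire and $g(0)=0$. For a harmonic entire mapping $F$ (in particular for an entire function $F$) and $r>0$ let $M(r,F)=\max_{0\le\theta<2\pi}|F(re^{i\theta})|$. The order of $F$ is $\limsup_{r\to\infty}\frac{\log\log M(r,F)}{\log r}\in[0,\infty]$ (constants have order $0$ by convention). If the order $\rho_F$ of $F$ satisfies $0<\rho_F<\infty$, the type of $F$ is $\limsup_{r\to\infty}\frac{\log M(r,F)}{r^{\rho_F}}\in[0,\infty]$, where each function's own order is used. *)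

theory Defs
  imports "HOL-Analysis.Analysis"
begin

(* Twice continuously (real) differentiable on the whole plane with vanishing Laplacian.
   f' z and f'' z are the first and second real Frechet derivatives, so f'' z v w is the
   second derivative in the directions v and w; the directions 1 and \<i> are the two axes. *)
definition harmonic_entire :: "(complex \<Rightarrow> complex) \<Rightarrow> bool" where
  "harmonic_entire f \<longleftrightarrow>
     (\<exists>(f' :: complex \<Rightarrow> complex \<Rightarrow>\<^sub>L complex)
       (f'' :: complex \<Rightarrow> complex \<Rightarrow>\<^sub>L (complex \<Rightarrow>\<^sub>L complex)).
        (\<forall>z. (f has_derivative blinfun_apply (f' z)) (at z)) \<and>
        (\<forall>z. (f' has_derivative blinfun_apply (f'' z)) (at z)) \<and>
        continuous_on UNIV f'' \<and>
        (\<forall>z. blinfun_apply (blinfun_apply (f'' z) 1) 1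
            + blinfun_apply (blinfun_apply (f'' z) \<i>) \<i> = 0))"

definition canonical_decomposition ::
  "(complex \<Rightarrow> complex) \<Rightarrow> (complex \<Rightarrow> complex) \<Rightarrow> (complex \<Rightarrow> complex) \<Rightarrow> bool" where
  "canonical_decomposition f h g \<longleftrightarrow>
     h holomorphic_on UNIV \<and> g holomorphic_on UNIV \<and> g 0 = 0 \<and> (\<forall>z. f z = h z + cnj (g z))"

(* For continuous F the supremum is finite and attained, i.e. it is a maximum. *)
definition max_modulus :: "real \<Rightarrow> (complex \<Rightarrow> complex) \<Rightarrow> real" where
  "max_modulus r F = (SUP \<theta>\<in>{0..<2 * pi}. cmod (F (complex_of_real r * cis \<theta>)))"

(* For a non-constant harmonic entire mapping the maximum modulus tends to infinity, so that
   the iterated logarithm is taken of a number > 1 for all large r. *)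
definition growth_order :: "(complex \<Rightarrow> complex) \<Rightarrow> ereal" where
  "growth_order F =
     (if F constant_on UNIV then 0
      else Limsup at_top (\<lambda>r::real. ereal (ln (ln (max_modulus r F)) / ln r)))"

(* Only meaningful if 0 < growth_order F < \<infinity>. *)
definition growth_type :: "(complex \<Rightarrow> complex) \<Rightarrow> ereal" where
  "growth_type F =
     Limsup at_top
       (\<lambda>r::real. ereal (ln (max_modulus r F) / r powr real_of_ereal (growth_order F)))"

end

theory Submission
  imports Defs "HOL-Complex_Analysis.Complex_Analysis" "HOL-Real_Asymp.Real_Asymp"
begin

text \<open>Since \<open>g 0 = 0\<close>, the Cauchy integral over \<open>cmod w = R\<close> annihilates \<open>cnj \<circ> g\<close>, so that of \<open>f\<close>
  reproduces \<open>h\<close>. Hence the maximum moduli of \<open>h\<close> and \<open>g\<close> at radius \<open>r\<close> are at most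
  \<open>2 (r + 1)\<close> times that of \<open>f\<close> at radius \<open>r + 1\<close>. Neither the polynomial factor nor the unit
  shift of the radius affects order or type. The same bound with \<open>R \<ge> 2 cmod z\<close> and Liouville's
  theorem show that the maximum modulus of a non-constant mapping tends to infinity.\<close>

section \<open>Elementary properties of the maximum modulus\<close>

text \<open>Compactness of the closed interval of angles bounds the values over the half-open one,
  so the real supremum is a genuine upper bound.\<close>

lemma norm_le_max_modulus:
  assumes "continuous_on UNIV F"
  shows "cmod (F z) \<le> max_modulus (cmod z) F"
proof -
  let ?G = "\<lambda>\<theta>. cmod (F (complex_of_real (cmod z) * cis \<theta>))"
  have "continuous_on {0..2*pi} (\<lambda>\<theta>. F (complex_of_real (cmod z) * cis \<theta>))"
    by (rule continuous_on_compose2[OF assms]) (auto intro!: continuous_intros)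
  then have "compact (?G ` {0..2*pi})"
    by (intro compact_continuous_image continuous_on_norm) auto
  then have "bdd_above (?G ` {0..2*pi})"
    by (intro bounded_imp_bdd_above compact_imp_bounded)
  then have bdd: "bdd_above (?G ` {0..<2*pi})"
    by (rule bdd_above_mono) (intro image_mono, auto)
  have "?G (Arg2pi z) \<le> (SUP \<theta>\<in>{0..<2*pi}. ?G \<theta>)"
    by (rule cSUP_upper[OF _ bdd]) (use Arg2pi_ge_0 Arg2pi_lt_2pi in auto)
  moreover have "complex_of_real (cmod z) * cis (Arg2pi z) = z"
    using Arg2pi_eq[of z] by (simp add: cis_conv_exp)
  ultimately show ?thesis
    by (simp add: max_modulus_def)
qed

lemma max_modulus_le:
  assumes "0 \<le> r" "\<And>z. cmod z = r \<Longrightarrow> cmod (F z) \<le> B"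
  shows "max_modulus r F \<le> B"
  unfolding max_modulus_def
  by (rule cSUP_least) (use assms in \<open>auto simp: norm_mult\<close>)

lemma max_modulus_nonneg:
  assumes "continuous_on UNIV F" "0 \<le> r"
  shows "0 \<le> max_modulus r F"
  using norm_le_max_modulus[OF assms(1), of "complex_of_real r"] assms(2)
  by (simp add: order_trans[OF norm_ge_zero])

section \<open>Cauchy estimates for the analytic and co-analytic parts\<close>

lemma canonical_decomposition_continuous:
  assumes "canonical_decomposition f h g"
  shows "continuous_on UNIV f" "continuous_on UNIV h" "continuous_on UNIV g"
proof -
  show h: "continuous_on UNIV h" and g: "continuous_on UNIV g"
    using assms by (auto simp: canonical_decomposition_def holomorphic_on_imp_continuous_on)
  have "f = (\<lambda>z. h z + cnj (g z))"
    using assms by (auto simp: canonical_decomposition_def)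
  with h g show "continuous_on UNIV f"
    by (auto intro!: continuous_intros)
qed

text \<open>On \<open>cmod w = R\<close> one has \<open>cnj w = R\<^sup>2 / w\<close>, so the conjugate of the integral is that of a
  function with at most a simple pole, at 0, whose residue \<open>g 0\<close> vanishes.\<close>

lemma contour_integral_cnj_Cauchy_kernel:
  assumes g: "g holomorphic_on UNIV" "g 0 = 0" and z: "cmod z < R"
  shows "((\<lambda>w. cnj (g w) / (w - z)) has_contour_integral 0) (circlepath 0 R)"
proof -
  have R: "R > 0"
    using z by (smt (verit) norm_ge_zero)
  define p where "p = circlepath 0 R"
  \<comment> \<open>On \<open>cmod w = R\<close>, where \<open>R^2 = w * cnj w\<close>, the
    conjugate of \<open>\<phi> w\<close> is \<open>w * cnj (g w) / (w - z)\<close>. A zero of the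
    denominator would need \<open>cmod z * cmod w = R^2\<close>, impossible in the closed disc
    because \<open>cmod z < R\<close>.\<close>
  define \<phi> where "\<phi> = (\<lambda>w. g w * of_real (R^2) / (of_real (R^2) - cnj z * w))"
  have nz: "of_real (R^2) - cnj z * w \<noteq> 0" if "cmod w \<le> R" for w
  proof
    assume "of_real (R^2) - cnj z * w = 0"
    then have "cnj z * w = of_real (R^2)" by simp
    then have "cmod z * cmod w = R^2"
      by (metis complex_mod_cnj norm_mult norm_of_real abs_power2 power2_abs)
    moreover have "cmod z * cmod w < R * R"
      using z that R by (smt (verit) mult_less_cancel_right mult_mono norm_ge_zero
        mult_left_mono)
    ultimately show False by (simp add: power2_eq_square)
  qed
  have "\<phi> holomorphic_on cball 0 R"
    unfolding \<phi>_def using nz holomorphic_on_subset[OF g(1)]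
    by (intro holomorphic_intros) auto
  \<comment> \<open>Cauchy's formula at the centre: the value is a multiple of
    \<open>\<phi> 0\<close>, which vanishes with \<open>g 0\<close>.\<close>
  from Cauchy_integral_circlepath_simple[OF this, of 0] R
  have "((\<lambda>w. \<phi> w / w) has_contour_integral 0) p"
    using g(2) by (simp add: p_def \<phi>_def)
  then have "((\<lambda>x. \<phi> (p x) / p x * vector_derivative p (at x)) has_integral 0) {0..1}"
    by (simp add: has_contour_integral)
  \<comment> \<open>Conjugation commutes with the integral over the real parameter, not with the
    contour integral. The minus sign offsets \<open>cnj \<i> = - \<i>\<close> from the derivative
    \<open>2 * pi * \<i> * w\<close> of the circle.\<close>
  from has_integral_neg[OF has_integral_cnj[THEN iffD2, OF this[folded complex_cnj_zero_iff]]]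
  have "((\<lambda>x. - cnj (\<phi> (p x) / p x * vector_derivative p (at x))) has_integral 0) {0..1}"
    by simp
  moreover have "- cnj (\<phi> (p x) / p x * vector_derivative p (at x))
      = cnj (g (p x)) / (p x - z) * vector_derivative p (at x)" for x
  proof -
    define w where "w = p x"
    have w: "w = of_real R * exp (2 * of_real pi * \<i> * of_real x)"
      by (simp add: w_def p_def circlepath)
    have vd: "vector_derivative p (at x) = 2 * of_real pi * \<i> * w"
      by (simp add: w p_def vector_derivative_circlepath)
    have nw: "cmod w = R"
      using R by (simp add: w norm_mult)
    then have w0: "w \<noteq> 0" using R by auto
    have ww: "of_real (R^2) = w * cnj w"
      using nw by (simp add: complex_norm_square[symmetric])
    have "- cnj (\<phi> w / w * (2 * of_real pi * \<i> * w))
        = cnj (g w) / (w - z) * (2 * of_real pi * \<i> * w)"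
    proof -
      have "\<phi> w = g w * (w * cnj w) / (w * (cnj w - cnj z))"
        by (simp add: \<phi>_def ww[simplified] algebra_simps)
      also have "\<dots> = g w * cnj w / (cnj w - cnj z)"
        using w0 by simp
      finally have "cnj (\<phi> w) = cnj (g w) * w / (w - z)" by simp
      then show ?thesis by simp
    qed
    then show ?thesis by (simp add: vd w_def)
  qed
  ultimately show ?thesis
    by (simp add: has_contour_integral p_def)
qed

text \<open>The Cauchy integral of \<open>f\<close> gives \<open>h z\<close>, since the contribution
  of \<open>cnj \<circ> g\<close> is 0. The kernel is at most \<open>1 / (R - cmod z)\<close> and
  the circle has length \<open>2 * pi * R\<close>.\<close>

lemma analytic_part_bound:
  assumes d: "canonical_decomposition f h g" and z: "cmod z < R"
  shows "cmod (h z) \<le> R / (R - cmod z) * max_modulus R f"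
proof -
  have R: "R > 0"
    using z by (smt (verit) norm_ge_zero)
  have h: "h holomorphic_on UNIV" and g: "g holomorphic_on UNIV" "g 0 = 0"
    and f: "\<And>w. f w = h w + cnj (g w)"
    using d by (auto simp: canonical_decomposition_def)
  have "((\<lambda>w. h w / (w - z) + cnj (g w) / (w - z))
      has_contour_integral (2 * of_real pi * \<i> * h z + 0)) (circlepath 0 R)"
    using h z by (intro has_contour_integral_add contour_integral_cnj_Cauchy_kernel[OF g z]
        Cauchy_integral_circlepath_simple) (auto intro: holomorphic_on_subset)
  then have "((\<lambda>w. f w / (w - z)) has_contour_integral (2 * of_real pi * \<i> * h z))
      (circlepath 0 R)"
    by (simp add: f add_divide_distrib)
  then have "cmod (2 * of_real pi * \<i> * h z)
      \<le> max_modulus R f / (R - cmod z) * (2 * pi * R)"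
  proof (rule has_contour_integral_bound_circlepath[OF _ _ R])
    show "0 \<le> max_modulus R f / (R - cmod z)"
      using max_modulus_nonneg[of f R] canonical_decomposition_continuous(1)[OF d] R z by simp
    fix w assume "cmod (w - 0) = R"
    then have w: "cmod w = R" by simp
    have "R - cmod z \<le> cmod (w - z)"
      using norm_triangle_ineq2[of w z] w by simp
    moreover have "cmod (f w) \<le> max_modulus R f"
      using norm_le_max_modulus[OF canonical_decomposition_continuous(1)[OF d], of w] w by simp
    ultimately show "cmod (f w / (w - z)) \<le> max_modulus R f / (R - cmod z)"
      using z by (auto simp: norm_divide intro!: frac_le order_trans[OF norm_ge_zero])
  qed
  then have "2 * pi * cmod (h z) \<le> 2 * pi * (R / (R - cmod z) * max_modulus R f)"
    by (simp add: norm_mult mult_ac)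
  then show ?thesis
    by (subst (asm) mult_le_cancel_left_pos) auto
qed

text \<open>Conjugating \<open>f\<close> exchanges the two parts. Subtracting
  \<open>cnj (h 0)\<close> restores the normalization at 0, and the estimate for \<open>h\<close> at
  the centre bounds this constant by the maximum modulus of \<open>f\<close>, whence the factor
  2.\<close>

lemma antianalytic_part_bound:
  assumes d: "canonical_decomposition f h g" and z: "cmod z < R"
  shows "cmod (g z) \<le> 2 * R / (R - cmod z) * max_modulus R f"
proof -
  have R: "R > 0"
    using z by (smt (verit) norm_ge_zero)
  define F where "F = (\<lambda>w. cnj (f w) - cnj (h 0))"
  have "canonical_decomposition F g (\<lambda>w. h w - h 0)"
    using d by (auto simp: canonical_decomposition_def F_def intro!: holomorphic_intros)
  then have A: "cmod (g z) \<le> R / (R - cmod z) * max_modulus R F"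
    using z by (rule analytic_part_bound)
  have "max_modulus R F \<le> 2 * max_modulus R f"
  proof (rule max_modulus_le)
    fix w assume w: "cmod w = R"
    have "cmod (F w) \<le> cmod (f w) + cmod (h 0)"
      unfolding F_def by (metis complex_mod_cnj norm_triangle_ineq4)
    moreover have "cmod (f w) \<le> max_modulus R f"
      using norm_le_max_modulus[OF canonical_decomposition_continuous(1)[OF d], of w] w by simp
    moreover have "cmod (h 0) \<le> max_modulus R f"
      using analytic_part_bound[OF d, of 0 R] R by simp
    ultimately show "cmod (F w) \<le> 2 * max_modulus R f" by simp
  qed (use R in simp)
  then have B: "R / (R - cmod z) * max_modulus R F \<le> R / (R - cmod z) * (2 * max_modulus R f)"
    by (rule mult_left_mono) (use z R in simp)
  from order_trans[OF A B] show ?thesis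
    by (simp add: mult_ac)
qed

section \<open>Comparison of maximum moduli and their divergence\<close>

lemma max_modulus_parts_le:
  assumes d: "canonical_decomposition f h g" and "0 \<le> r"
  shows "max_modulus r h \<le> 2 * (r + 1) * max_modulus (r + 1) f"
    and "max_modulus r g \<le> 2 * (r + 1) * max_modulus (r + 1) f"
proof -
  have m: "0 \<le> max_modulus (r + 1) f"
    using max_modulus_nonneg[of f "r + 1"] canonical_decomposition_continuous(1)[OF d] assms(2)
    by simp
  show "max_modulus r h \<le> 2 * (r + 1) * max_modulus (r + 1) f"
  proof (rule max_modulus_le[OF assms(2)])
    fix z assume "cmod z = r"
    then have "cmod (h z) \<le> (r + 1) * max_modulus (r + 1) f"
      using analytic_part_bound[OF d, of z "r + 1"] by simp
    then show "cmod (h z) \<le> 2 * (r + 1) * max_modulus (r + 1) f"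
      using mult_nonneg_nonneg[OF _ m, of "r + 1"] assms(2) by linarith
  qed
  show "max_modulus r g \<le> 2 * (r + 1) * max_modulus (r + 1) f"
  proof (rule max_modulus_le[OF assms(2)])
    fix z assume "cmod z = r"
    then show "cmod (g z) \<le> 2 * (r + 1) * max_modulus (r + 1) f"
      using antianalytic_part_bound[OF d, of z "r + 1"] by simp
  qed
qed

lemma max_modulus_le_parts:
  assumes d: "canonical_decomposition f h g" and "0 \<le> r"
  shows "max_modulus r f \<le> max_modulus r h + max_modulus r g"
proof (rule max_modulus_le[OF assms(2)])
  fix z assume z: "cmod z = r"
  have "cmod (f z) \<le> cmod (h z) + cmod (g z)"
    using d by (metis canonical_decomposition_def complex_mod_cnj norm_triangle_ineq)
  then show "cmod (f z) \<le> max_modulus r h + max_modulus r g"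
    using norm_le_max_modulus[OF canonical_decomposition_continuous(2)[OF d], of z]
      norm_le_max_modulus[OF canonical_decomposition_continuous(3)[OF d], of z] z by simp
qed

lemma unbounded_of_nonconstant_entire:
  assumes "h holomorphic_on UNIV" "\<not> h constant_on UNIV"
  obtains z where "C < cmod (h z)"
proof -
  have "\<not> (\<forall>z. cmod (h z) \<le> C)"
  proof
    assume "\<forall>z. cmod (h z) \<le> C"
    then have "bounded (range h)"
      unfolding bounded_iff by blast
    from Liouville_theorem[OF assms(1) this] assms(2) show False
      unfolding constant_on_def by blast
  qed
  then show thesis
    using that by (auto simp: not_le)
qed

text \<open>One point \<open>z\<close> at which \<open>h\<close> or \<open>g\<close> is large forces
  \<open>f\<close> to be large on every circle of radius beyond \<open>2 * cmod z\<close>, so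
  monotonicity in the radius does not enter.\<close>

lemma filterlim_max_modulus:
  assumes d: "canonical_decomposition f h g" and "\<not> f constant_on UNIV"
  shows "filterlim (\<lambda>r. max_modulus r f) at_top at_top"
  unfolding filterlim_at_top
proof
  fix C :: real
  have "\<not> h constant_on UNIV \<or> \<not> g constant_on UNIV"
    using assms unfolding canonical_decomposition_def constant_on_def by (metis UNIV_I)
  \<comment> \<open>The 4 combines the factor 2 of the bound for \<open>g\<close> with
    \<open>r / (r - cmod z) \<le> 2\<close>.\<close>
  then obtain z where z: "4 * \<bar>C\<bar> < cmod (h z) \<or> 4 * \<bar>C\<bar> < cmod (g z)"
    using d unbounded_of_nonconstant_entire unfolding canonical_decomposition_def by metis
  \<comment> \<open>The summand 1 in the threshold ensures \<open>cmod z < r\<close> even for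
    \<open>z = 0\<close>.\<close>
  show "eventually (\<lambda>r. C \<le> max_modulus r f) at_top"
  proof (rule eventually_mono[OF eventually_ge_at_top[of "2 * cmod z + 1"]])
    fix r assume r: "2 * cmod z + 1 \<le> r"
    have m: "0 \<le> max_modulus r f"
      using max_modulus_nonneg[OF canonical_decomposition_continuous(1)[OF d], of r] r
        norm_ge_zero[of z] by linarith
    have zr: "cmod z < r" using r norm_ge_zero[of z] by linarith
    have q: "r / (r - cmod z) \<le> 2"
      using r zr by (simp add: field_simps)
    have "cmod (h z) \<le> 2 * max_modulus r f"
      using analytic_part_bound[OF d zr] mult_right_mono[OF q m] by linarith
    moreover have "cmod (g z) \<le> 4 * max_modulus r f"
      using antianalytic_part_bound[OF d zr] mult_right_mono[OF q m] by simp
    ultimately show "C \<le> max_modulus r f"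
      using z m by linarith
  qed
qed

section \<open>Eventual exponential bounds\<close>

text \<open>Order and type are both compared through such bounds: the order with
  \<open>t = 1\<close> and varying \<open>p\<close>, the type with fixed \<open>p\<close> and
  varying \<open>t\<close>.\<close>

definition exp_bounded :: "real \<Rightarrow> real \<Rightarrow> (complex \<Rightarrow> complex) \<Rightarrow> bool" where
  "exp_bounded t p F \<longleftrightarrow> (\<forall>\<^sub>F r in at_top. max_modulus r F \<le> exp (t * r powr p))"

text \<open>The exponent is a parameter, so that functions of different orders can be compared on
  the same scale.\<close>

definition growth_type_at :: "real \<Rightarrow> (complex \<Rightarrow> complex) \<Rightarrow> ereal" where
  "growth_type_at p F = Limsup at_top (\<lambda>r::real. ereal (ln (max_modulus r F) / r powr p))"

lemma growth_type_eq: "growth_type F = growth_type_at (real_of_ereal (growth_order F)) F"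
  by (simp add: growth_type_def growth_type_at_def)

lemma exp_bounded_less:
  assumes "exp_bounded t p F" "0 < t" "0 < t'" "0 < p" "p < p' \<or> p = p' \<and> t \<le> t'"
  shows "exp_bounded t' p' F"
proof -
  have "eventually (\<lambda>r::real. t * r powr p \<le> t' * r powr p') at_top"
  proof (cases "p < p'")
    case True
    then show ?thesis using assms(2-4) by real_asymp
  next
    case False
    then show ?thesis using assms(5) by (auto intro!: always_eventually mult_right_mono)
  qed
  with assms(1) show ?thesis
    unfolding exp_bounded_def by eventually_elim (meson exp_le_cancel_iff order_trans)
qed

text \<open>The factor 2 from adding two equal bounds is absorbed by the increase from
  \<open>t\<close> to \<open>t'\<close>.\<close>

lemma exp_bounded_sum:
  assumes d: "canonical_decomposition f h g" and "0 < p" "0 < t" "t < t'"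
    and "exp_bounded t p h" "exp_bounded t p g"
  shows "exp_bounded t' p f"
proof -
  have "eventually (\<lambda>r::real. 2 * exp (t * r powr p) \<le> exp (t' * r powr p)) at_top"
    using assms(2-4) by real_asymp
  with assms(5,6) eventually_ge_at_top[of 0] show ?thesis
    unfolding exp_bounded_def
    by eventually_elim (use max_modulus_le_parts[OF d] in force)
qed

text \<open>Since \<open>(r + 1) powr p\<close> is asymptotic to \<open>r powr p\<close> and
  \<open>ln (2 * (r + 1))\<close> is of smaller growth, any increase of \<open>t\<close> absorbs
  both the shift of the radius and the polynomial factor.\<close>

lemma exp_bounded_parts:
  assumes d: "canonical_decomposition f h g" and "0 < p" "0 < t" "t < t'"
    and f: "exp_bounded t p f"
  shows "exp_bounded t' p h" "exp_bounded t' p g"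
proof -
  have "eventually (\<lambda>r::real. ln (2 * (r + 1)) + t * (r + 1) powr p \<le> t' * r powr p) at_top"
    using assms(2-4) by real_asymp
  then have 1: "eventually (\<lambda>r::real. 2 * (r + 1) * exp (t * (r + 1) powr p) \<le> exp (t' * r powr p)) at_top"
    using eventually_ge_at_top[of 0]
  proof eventually_elim
    case (elim r)
    then have "exp (ln (2 * (r + 1)) + t * (r + 1) powr p) \<le> exp (t' * r powr p)"
      by simp
    then show ?case using elim(2) by (simp add: exp_add)
  qed
  have "filterlim (\<lambda>r::real. r + 1) at_top at_top" by real_asymp
  from eventually_compose_filterlim[OF f[unfolded exp_bounded_def] this]
  have "eventually (\<lambda>r. max_modulus (r + 1) f \<le> exp (t * (r + 1) powr p)) at_top" .
  with 1 eventually_ge_at_top[of 0]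
  have 2: "eventually (\<lambda>r. 0 \<le> r \<and> 2 * (r + 1) * max_modulus (r + 1) f \<le> exp (t' * r powr p)) at_top"
  proof eventually_elim
    case (elim r)
    have "2 * (r + 1) * max_modulus (r + 1) f \<le> 2 * (r + 1) * exp (t * (r + 1) powr p)"
      using elim by (intro mult_left_mono) auto
    then show ?case using elim by linarith
  qed
  show "exp_bounded t' p h" "exp_bounded t' p g"
    unfolding exp_bounded_def
    by (rule eventually_mono[OF 2], use max_modulus_parts_le[OF d] in \<open>blast intro: order_trans\<close>)+
qed

section \<open>Translation between exponential bounds, type and order\<close>

lemma exp_bounded_of_type_less:
  assumes "filterlim (\<lambda>r. max_modulus r F) at_top at_top" "growth_type_at p F < ereal t"
  shows "exp_bounded t p F"
proof -
  have "eventually (\<lambda>r. 1 < max_modulus r F) at_top"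
    using assms(1) by (simp add: filterlim_at_top_dense)
  with Limsup_lessD[OF assms(2)[unfolded growth_type_at_def]] eventually_gt_at_top[of 0]
  show ?thesis unfolding exp_bounded_def
  proof eventually_elim
    case (elim r)
    then have "ln (max_modulus r F) \<le> t * r powr p"
      by (simp add: field_simps)
    moreover have "0 < max_modulus r F" using elim by simp
    ultimately show ?case by (metis exp_le_cancel_iff exp_ln)
  qed
qed

lemma type_le_of_exp_bounded:
  assumes "filterlim (\<lambda>r. max_modulus r F) at_top at_top" "exp_bounded t p F"
  shows "growth_type_at p F \<le> ereal t"
  unfolding growth_type_at_def
proof (rule Limsup_bounded)
  have "eventually (\<lambda>r. 1 < max_modulus r F) at_top"
    using assms(1) by (simp add: filterlim_at_top_dense)
  with assms(2)[unfolded exp_bounded_def] eventually_gt_at_top[of 0]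
  show "eventually (\<lambda>r. ereal (ln (max_modulus r F) / r powr p) \<le> ereal t) at_top"
  proof eventually_elim
    case (elim r)
    then have "ln (max_modulus r F) \<le> t * r powr p"
      by (metis ln_exp ln_le_cancel_iff exp_gt_zero less_trans zero_less_one)
    then show ?case using elim by (simp add: field_simps)
  qed
qed

lemma growth_type_at_nonneg:
  assumes "filterlim (\<lambda>r. max_modulus r F) at_top at_top"
  shows "0 \<le> growth_type_at p F"
  unfolding growth_type_at_def
proof (rule le_Limsup)
  have "eventually (\<lambda>r. 1 < max_modulus r F) at_top"
    using assms(1) by (simp add: filterlim_at_top_dense)
  then show "eventually (\<lambda>r. 0 \<le> ereal (ln (max_modulus r F) / r powr p)) at_top"
    by eventually_elim simp
qed simp

text \<open>A constant, of order 0 by convention, lies below \<open>exp (r powr s)\<close>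
  eventually because \<open>0 < s\<close>. Otherwise the two logarithms in the order are undone by
  exponentials.\<close>

lemma exp_bounded_of_order_less:
  assumes "F constant_on UNIV \<or> filterlim (\<lambda>r. max_modulus r F) at_top at_top"
    and "growth_order F < ereal s" "0 < s"
  shows "exp_bounded 1 s F"
proof (cases "F constant_on UNIV")
  case True
  then obtain c where c: "\<And>z. F z = c" by (auto simp: constant_on_def)
  have "max_modulus r F = cmod c" for r
    by (simp add: max_modulus_def c)
  moreover have "eventually (\<lambda>r::real. cmod c \<le> exp (1 * r powr s)) at_top"
    using assms(3) by real_asymp
  ultimately show ?thesis by (simp add: exp_bounded_def)
next
  case False
  \<comment> \<open>Above the threshold \<open>exp 1\<close> the inner logarithm exceeds 1, so the
    outer one has a positive argument.\<close>
  then have "eventually (\<lambda>r. exp 1 < max_modulus r F) at_top"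
    using assms(1) by (simp add: filterlim_at_top_dense)
  moreover have "eventually (\<lambda>r. ereal (ln (ln (max_modulus r F)) / ln r) < ereal s) at_top"
    using assms(2) False by (intro Limsup_lessD) (simp add: growth_order_def)
  ultimately show ?thesis
    using eventually_gt_at_top[of 1] unfolding exp_bounded_def
  proof eventually_elim
    case (elim r)
    have m: "0 < max_modulus r F" using elim(1) by (meson exp_gt_zero less_trans)
    have l: "1 < ln (max_modulus r F)"
      using elim(1) m by (metis exp_less_cancel_iff exp_ln)
    have "ln (ln (max_modulus r F)) < s * ln r"
      using elim by (simp add: field_simps)
    then have "ln (max_modulus r F) < exp (s * ln r)"
      using l by (metis exp_less_cancel_iff exp_ln less_trans zero_less_one)
    then show ?case
      using elim(3) m by (simp add: powr_def) (metis exp_le_cancel_iff exp_ln less_imp_le)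
  qed
qed

lemma order_le_of_exp_bounded:
  assumes "F constant_on UNIV \<or> filterlim (\<lambda>r. max_modulus r F) at_top at_top"
    and "exp_bounded 1 s F" "0 < s"
  shows "growth_order F \<le> ereal s"
proof (cases "F constant_on UNIV")
  case True
  then show ?thesis using assms(3) by (simp add: growth_order_def)
next
  case False
  then have "eventually (\<lambda>r. exp 1 < max_modulus r F) at_top"
    using assms(1) by (simp add: filterlim_at_top_dense)
  with assms(2)[unfolded exp_bounded_def] eventually_gt_at_top[of 1]
  have "eventually (\<lambda>r. ereal (ln (ln (max_modulus r F)) / ln r) \<le> ereal s) at_top"
  proof eventually_elim
    case (elim r)
    have m: "0 < max_modulus r F" using elim(3) by (meson exp_gt_zero less_trans)
    have l: "1 < ln (max_modulus r F)"
      using elim(3) m by (metis exp_less_cancel_iff exp_ln)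
    have "ln (max_modulus r F) \<le> r powr s"
      using elim(1) m by (metis ln_exp ln_le_cancel_iff exp_gt_zero mult_1)
    then have "ln (ln (max_modulus r F)) \<le> ln (r powr s)"
      using l elim(2) by (subst ln_le_cancel_iff) auto
    then show ?case using elim(2) by (simp add: ln_powr field_simps)
  qed
  then show ?thesis
    using False by (simp add: growth_order_def Limsup_bounded)
qed

lemma growth_order_nonneg:
  assumes "F constant_on UNIV \<or> filterlim (\<lambda>r. max_modulus r F) at_top at_top"
  shows "0 \<le> growth_order F"
proof (cases "F constant_on UNIV")
  case True
  then show ?thesis by (simp add: growth_order_def)
next
  case False
  then have "eventually (\<lambda>r. exp 1 < max_modulus r F) at_top"
    using assms(1) by (simp add: filterlim_at_top_dense)
  with eventually_gt_at_top[of 1]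
  have "eventually (\<lambda>r. 0 \<le> ereal (ln (ln (max_modulus r F)) / ln r)) at_top"
  proof eventually_elim
    case (elim r)
    have "1 < ln (max_modulus r F)"
      using elim(2) by (metis exp_gt_zero exp_less_cancel_iff exp_ln less_trans)
    then show ?case using elim(1) by simp
  qed
  then show ?thesis
    using False by (simp add: growth_order_def le_Limsup)
qed

section \<open>Maximum formulas for order and type\<close>

text \<open>Every \<open>y > b\<close> leaves room for \<open>b < s < s' < y\<close>. The step from
  \<open>s\<close> to \<open>s'\<close> accommodates the arbitrarily small loss in each transfer of
  exponential bounds; \<open>0 \<le> b\<close> makes \<open>s\<close> positive.\<close>

lemma ereal_le_of_dense:
  fixes a b :: ereal
  assumes "0 \<le> b" "\<And>s s'. \<lbrakk>b < ereal s; 0 < s; s < s'\<rbrakk> \<Longrightarrow> a \<le> ereal s'"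
  shows "a \<le> b"
proof (rule dense_ge)
  fix y assume "b < y"
  then obtain s' where s': "b < ereal s'" "ereal s' < y"
    using ereal_dense2 by blast
  then obtain s where s: "b < ereal s" "ereal s < ereal s'"
    using ereal_dense2 by blast
  have "0 < s" using assms(1) s(1) by (metis ereal_less(2) order_le_less_trans)
  then show "a \<le> y"
    using assms(2)[OF s(1), of s'] s(2) s'(2) by (simp add: order_trans less_imp_le)
qed

text \<open>Makes results on \<open>f\<close>, notably the divergence of the maximum modulus,
  applicable to \<open>h\<close> and \<open>g\<close> themselves.\<close>

lemma canonical_decomposition_parts:
  assumes "canonical_decomposition f h g"
  shows "canonical_decomposition h h (\<lambda>_. 0)" "canonical_decomposition g g (\<lambda>_. 0)"
  using assms by (auto simp: canonical_decomposition_def)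

lemma growth_order_eq_max:
  assumes d: "canonical_decomposition f h g"
  shows "growth_order f = max (growth_order h) (growth_order g)"
proof -
  note lim = filterlim_max_modulus[OF d]
    filterlim_max_modulus[OF canonical_decomposition_parts(1)[OF d]]
    filterlim_max_modulus[OF canonical_decomposition_parts(2)[OF d]]
  have f: "f constant_on UNIV \<or> filterlim (\<lambda>r. max_modulus r f) at_top at_top"
    and h: "h constant_on UNIV \<or> filterlim (\<lambda>r. max_modulus r h) at_top at_top"
    and g: "g constant_on UNIV \<or> filterlim (\<lambda>r. max_modulus r g) at_top at_top"
    using lim by blast+
  show ?thesis
  proof (rule antisym)
    show "growth_order f \<le> max (growth_order h) (growth_order g)"
    proof (rule ereal_le_of_dense)
      show "0 \<le> max (growth_order h) (growth_order g)"
        using growth_order_nonneg[OF h] by (simp add: le_max_iff_disj)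
      fix s s' :: real
      assume s: "max (growth_order h) (growth_order g) < ereal s" "0 < s" "s < s'"
      have "exp_bounded 1 s h" "exp_bounded 1 s g"
        using exp_bounded_of_order_less[OF h] exp_bounded_of_order_less[OF g] s by auto
      \<comment> \<open>The coefficient 2 is an arbitrary choice above 1; raising the exponent to
        \<open>s'\<close> brings it back to 1.\<close>
      then have "exp_bounded 2 s f"
        using exp_bounded_sum[OF d, of s 1 2] s by simp
      then have "exp_bounded 1 s' f"
        using exp_bounded_less[of 2 s f 1 s'] s by simp
      then show "growth_order f \<le> ereal s'"
        using order_le_of_exp_bounded[OF f] s by simp
    qed
    have "growth_order h \<le> growth_order f \<and> growth_order g \<le> growth_order f"
    proof -
      have "exp_bounded 1 s' h \<and> exp_bounded 1 s' g"
        if s: "growth_order f < ereal s" "0 < s" "s < s'" for s s'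
        using exp_bounded_parts[OF d, of s 1 2] exp_bounded_of_order_less[OF f]
          exp_bounded_less[of 2 s _ 1 s'] s by simp
      then show ?thesis
        using order_le_of_exp_bounded[OF h] order_le_of_exp_bounded[OF g]
        by (intro conjI; intro ereal_le_of_dense[OF growth_order_nonneg[OF f]]) fastforce+
    qed
    then show "max (growth_order h) (growth_order g) \<le> growth_order f" by simp
  qed
qed

text \<open>The exponent stays fixed here, and the loss is taken by the coefficient, which grows
  from \<open>s\<close> to \<open>s'\<close>.\<close>

lemma growth_type_at_eq_max:
  assumes d: "canonical_decomposition f h g" and p: "0 < p"
    and f: "filterlim (\<lambda>r. max_modulus r f) at_top at_top"
    and h: "filterlim (\<lambda>r. max_modulus r h) at_top at_top"
    and g: "filterlim (\<lambda>r. max_modulus r g) at_top at_top"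
  shows "growth_type_at p f = max (growth_type_at p h) (growth_type_at p g)"
proof (rule antisym)
  show "growth_type_at p f \<le> max (growth_type_at p h) (growth_type_at p g)"
  proof (rule ereal_le_of_dense)
    show "0 \<le> max (growth_type_at p h) (growth_type_at p g)"
      using growth_type_at_nonneg[OF h] by (simp add: le_max_iff_disj)
    fix s s' :: real
    assume s: "max (growth_type_at p h) (growth_type_at p g) < ereal s" "0 < s" "s < s'"
    have "exp_bounded s p h" "exp_bounded s p g"
      using exp_bounded_of_type_less[OF h] exp_bounded_of_type_less[OF g] s by auto
    then show "growth_type_at p f \<le> ereal s'"
      using exp_bounded_sum[OF d p] type_le_of_exp_bounded[OF f] s by blast
  qed
  have "exp_bounded s' p h \<and> exp_bounded s' p g"
    if "growth_type_at p f < ereal s" "0 < s" "s < s'" for s s'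
    using exp_bounded_parts[OF d p] exp_bounded_of_type_less[OF f] that by blast
  then have "growth_type_at p h \<le> growth_type_at p f \<and> growth_type_at p g \<le> growth_type_at p f"
    using type_le_of_exp_bounded[OF h] type_le_of_exp_bounded[OF g]
    by (intro conjI; intro ereal_le_of_dense[OF growth_type_at_nonneg[OF f]]) fastforce+
  then show "max (growth_type_at p h) (growth_type_at p g) \<le> growth_type_at p f" by simp
qed

text \<open>For \<open>s\<close> strictly between the order and \<open>p\<close>, the bound
  \<open>exp (r powr s)\<close> is eventually below \<open>exp (t * r powr p)\<close> for every
  \<open>t > 0\<close>.\<close>

lemma growth_type_at_eq_0:
  assumes F: "filterlim (\<lambda>r. max_modulus r F) at_top at_top"
    and "growth_order F < ereal p"
  shows "growth_type_at p F = 0"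
proof (rule antisym)
  obtain s where s: "growth_order F < ereal s" "ereal s < ereal p"
    using ereal_dense2[OF assms(2)] by blast
  have s0: "0 < s"
    using growth_order_nonneg[OF disjI2[OF F]] s(1) by (metis ereal_less(2) order_le_less_trans)
  have "exp_bounded 1 s F"
    using exp_bounded_of_order_less[OF disjI2[OF F] s(1) s0] .
  then have "exp_bounded t p F" if "0 < t" for t
    using exp_bounded_less[of 1 s F t p] that s s0 by simp
  then have "growth_type_at p F \<le> ereal t" if "0 < t" for t
    using type_le_of_exp_bounded[OF F] that by blast
  then show "growth_type_at p F \<le> 0"
    by (rule ereal_le_of_dense[OF order_refl]) linarith
qed (rule growth_type_at_nonneg[OF F])

theorem theorem3:
  fixes f h g :: "complex \<Rightarrow> complex"
    and \<rho> \<rho>\<^sub>h \<rho>\<^sub>g :: ereal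
  assumes "harmonic_entire f"
    and "canonical_decomposition f h g"
    and "growth_order f = \<rho>" and "growth_order h = \<rho>\<^sub>h" and "growth_order g = \<rho>\<^sub>g"
  shows "\<rho> = max \<rho>\<^sub>h \<rho>\<^sub>g \<and>
    (\<forall>\<tau> \<tau>\<^sub>h \<tau>\<^sub>g :: ereal.
       0 < \<rho>\<^sub>h \<and> \<rho>\<^sub>h < \<infinity> \<and> 0 < \<rho>\<^sub>g \<and> \<rho>\<^sub>g < \<infinity> \<and>
       growth_type f = \<tau> \<and> growth_type h = \<tau>\<^sub>h \<and> growth_type g = \<tau>\<^sub>g \<longrightarrow>
       \<tau> = (if \<rho>\<^sub>g < \<rho>\<^sub>h then \<tau>\<^sub>h
            else if \<rho>\<^sub>g > \<rho>\<^sub>h then \<tau>\<^sub>g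
            else max \<tau>\<^sub>h \<tau>\<^sub>g))"
proof (intro conjI allI impI)
  note d = assms(2)
  show \<rho>: "\<rho> = max \<rho>\<^sub>h \<rho>\<^sub>g"
    using growth_order_eq_max[OF d] assms by simp
  fix \<tau> \<tau>\<^sub>h \<tau>\<^sub>g :: ereal
  assume A: "0 < \<rho>\<^sub>h \<and> \<rho>\<^sub>h < \<infinity> \<and> 0 < \<rho>\<^sub>g \<and> \<rho>\<^sub>g < \<infinity> \<and>
       growth_type f = \<tau> \<and> growth_type h = \<tau>\<^sub>h \<and> growth_type g = \<tau>\<^sub>g"
  obtain a b where ab: "\<rho>\<^sub>h = ereal a" "\<rho>\<^sub>g = ereal b" "0 < a" "0 < b"
    using A by (cases \<rho>\<^sub>h; cases \<rho>\<^sub>g) auto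
  \<comment> \<open>This is the order of \<open>f\<close>; the types of all three functions are
    first compared at this exponent.\<close>
  define p where "p = max a b"
  have p: "\<rho> = ereal p" "0 < p"
    using ab \<rho> by (auto simp: p_def)
  \<comment> \<open>Constants have order 0 by convention, so positive order excludes them and all
    three maximum moduli diverge.\<close>
  have nc: "\<not> F constant_on UNIV" if "growth_order F = ereal q" "0 < q" for F q
    using that by (auto simp: growth_order_def)
  have f: "filterlim (\<lambda>r. max_modulus r f) at_top at_top"
    and h: "filterlim (\<lambda>r. max_modulus r h) at_top at_top"
    and g: "filterlim (\<lambda>r. max_modulus r g) at_top at_top"
    using filterlim_max_modulus[OF d] filterlim_max_modulus[OF canonical_decomposition_parts(1)[OF d]]
      filterlim_max_modulus[OF canonical_decomposition_parts(2)[OF d]] nc assms(3-5) ab p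
    by blast+
  have types: "\<tau> = growth_type_at p f" "\<tau>\<^sub>h = growth_type_at a h" "\<tau>\<^sub>g = growth_type_at b g"
    using A assms(3-5) ab p by (auto simp: growth_type_eq)
  have eq: "\<tau> = max (growth_type_at p h) (growth_type_at p g)"
    unfolding types using growth_type_at_eq_max[OF d p(2) f h g] .
  consider "b < a" | "a < b" | "a = b" by linarith
  then show "\<tau> = (if \<rho>\<^sub>g < \<rho>\<^sub>h then \<tau>\<^sub>h else if \<rho>\<^sub>g > \<rho>\<^sub>h then \<tau>\<^sub>g else max \<tau>\<^sub>h \<tau>\<^sub>g)"
  proof cases
    \<comment> \<open>At the exponent \<open>p = a\<close>, the part of smaller order has type 0,
      which drops out of the maximum because the other type is nonnegative.\<close>
    case 1
    then have "growth_type_at p g = 0"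
      using growth_type_at_eq_0[OF g] assms(5) ab by (simp add: p_def)
    with 1 show ?thesis
      using eq types ab growth_type_at_nonneg[OF h, of a] by (simp add: p_def max_absorb1)
  next
    case 2
    then have "growth_type_at p h = 0"
      using growth_type_at_eq_0[OF h] assms(4) ab by (simp add: p_def)
    with 2 show ?thesis
      using eq types ab growth_type_at_nonneg[OF g, of b] by (simp add: p_def max_absorb2)
  next
    case 3
    then show ?thesis
      using eq types ab by (simp add: p_def)
  qed
qed

end
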